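(* There exists a countable fadelian ring which is neither left Noetherian nor right Noetherian.
   Context: All rings are nontrivial ($1\neq 0$), unital, associative, and not assumed commutative. A ring $R$ is fadelian if for every $x\in R$ and every nonzero $a\in R$ there exist $b,c\in R$ such that $x=ab+ca$. *)

theory Defs
  imports "HOL-Algebra.Ideal" "HOL-Library.Countable_Set"
begin

locale fadelian_ring = ring R for R (structure) +
  assumes one_not_zero: "\<one> \<noteq> \<zero>"
    and fadelian: "\<lbrakk>x \<in> carrier R; a \<in> carrier R; a \<noteq> \<zero>\<rbrakk>
      \<Longrightarrow> \<exists>b \<in> carrier R. \<exists>c \<in> carrier R. x = a \<otimes> b \<oplus> c \<otimes> a"

locale left_ideal = additive_subgroup I R + ring R for I and R (structure) +
  assumes I_l_closed: "\<lbrakk>a \<in> I; r \<in> carrier R\<rbrakk> \<Longrightarrow> r \<otimes> a \<in> I"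

locale right_ideal = additive_subgroup I R + ring R for I and R (structure) +
  assumes I_r_closed: "\<lbrakk>a \<in> I; r \<in> carrier R\<rbrakk> \<Longrightarrow> a \<otimes> r \<in> I"

(* The library's noetherian_ring speaks about two-sided ideals only, so the one-sided
   ascending chain conditions are introduced here. *)

definition left_noetherian :: "('a, 'b) ring_scheme \<Rightarrow> bool" where
  "left_noetherian R \<longleftrightarrow>
     (\<forall>C :: nat \<Rightarrow> 'a set. (\<forall>n. left_ideal (C n) R) \<and> (\<forall>n. C n \<subseteq> C (Suc n)) \<longrightarrow>
        (\<exists>N. \<forall>n\<ge>N. C n = C N))"

definition right_noetherian :: "('a, 'b) ring_scheme \<Rightarrow> bool" where
  "right_noetherian R \<longleftrightarrow>
     (\<forall>C :: nat \<Rightarrow> 'a set. (\<forall>n. right_ideal (C n) R) \<and> (\<forall>n. C n \<subseteq> C (Suc n)) \<longrightarrow>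
        (\<exists>N. \<forall>n\<ge>N. C n = C N))"

end

theory Submission
  imports Defs "HOL-Algebra.Algebraic_Closure_Type" "HOL-Library.Z2"
    "HOL-Library.Diagonal_Subsequence"
begin

text \<open>
  The fadelian property is first-order, while the ascending chain conditions are not.  So it is
  enough to have one fadelian domain with a nonzero nonunit \<open>z\<close>, Noetherian or not: in an ultrapower
  of it, the classes \<open>y\<^sub>n\<close> of the sequences \<open>(z\<^bsup>i - n\<^esup>)\<^sub>i\<close> satisfy
  \<open>y\<^sub>n = z * y\<^bsub>n + 1\<^esub> = y\<^bsub>n + 1\<^esub> * z\<close>, and they generate strictly increasing chains of
  principal left and right ideals, because cancelling \<open>y\<^bsub>n + 1\<^esub>\<close> in a reverse relation would make \<open>z\<close>
  invertible.  A countable subring that contains these elements and is closed under solving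
  \<open>x = a * b + c * a\<close> is the ring sought.

  Since only countably many sequences matter, a diagonal subsequence replaces the ultrafilter: it can be
  chosen such that each of these sequences is eventually zero or eventually nonzero along it
  (\<open>deciding_subsequence\<close>).  The ring then consists of the germs at infinity
  (\<open>ex_countable_non_noetherian_fadelian_ring\<close>).

  The fadelian domain consists of operators on an algebraic closure \<open>K\<close> of the field with two elements,
  generated by scalar multiplications, the squaring map \<open>\<phi>\<close> and its inverse.  By algebraic
  closedness, every nonzero operator is a product of units and copies of the Artin--Schreier map
  \<open>y \<mapsto> y\<^sup>2 + y\<close> (\<open>frobenius_op_induct\<close>).  Hence nonzero operators are surjective, which rules out zero
  divisors.  For nonzero operators \<open>r\<close> and \<open>f\<close>, every operator \<open>x\<close> has the form \<open>r * b + c * f\<close>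
  (\<open>frobenius_op_two_sided\<close>): this property is multiplicative in \<open>f\<close>, and for the Artin--Schreier map,
  whose kernel is \<open>{0, 1}\<close>, it says that \<open>x - r * b\<close> vanishes at \<open>1\<close> for a suitable \<open>b\<close>.  The
  Artin--Schreier map itself is the required nonunit.
\<close>

section \<open>Additive polynomials over an algebraically closed field of characteristic two\<close>

type_synonym K = "bit alg_closure"

lemma K_add_self: "x + x = (0 :: K)"
proof -
  have "(2 :: K) = to_ac 2"
    by (simp only: to_ac_numeral)
  then have "(2 :: K) = 0"
    by simp
  then show ?thesis
    by (metis mult_2 mult_zero_left)
qed

lemma K_uminus: "- x = (x :: K)"
  using K_add_self[of x] by (simp add: eq_neg_iff_add_eq_0 minus_unique)

lemma K_minus: "x - y = x + (y :: K)"
  by (metis K_uminus diff_conv_add_uminus)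

lemma K_square_add: "(x + y)\<^sup>2 = x\<^sup>2 + (y :: K)\<^sup>2"
proof -
  have "(x + y)\<^sup>2 = x\<^sup>2 + y\<^sup>2 + (x * y + x * y)"
    by (simp add: power2_eq_square algebra_simps)
  then show ?thesis
    by (simp add: K_add_self)
qed

lemma K_square_inject: "x\<^sup>2 = (y :: K)\<^sup>2 \<longleftrightarrow> x = y"
  by (metis K_uminus power2_eq_iff)

lemma K_frobenius_inject: "x ^ (2 ^ m) = (y :: K) ^ (2 ^ m) \<longleftrightarrow> x = y"
proof (induction m arbitrary: x y)
  case (Suc m)
  then show ?case
    by (simp add: power_mult K_square_inject)
qed simp

lemma K_frobenius_add: "(x + y) ^ (2 ^ m) = x ^ (2 ^ m) + (y :: K) ^ (2 ^ m)"
  by (induction m arbitrary: x y) (simp_all add: power_mult K_square_add)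

lemma K_square_root: "\<exists>x. x\<^sup>2 = (y :: K)"
  using nth_root_exists[of 2 y] by auto

text \<open>
  The list \<open>k\<^sub>0, k\<^sub>1, \<dots>\<close> stands for the additive polynomial
  \<open>k\<^sub>0 y + k\<^sub>1 y\<^sup>2 + k\<^sub>2 y\<^sup>4 + \<dots>\<close>; equivalently, for an element of the skew polynomial ring
  over \<^typ>\<open>K\<close> in the squaring map.  Lists, unlike functions, have a length to induct on.
\<close>

fun additive_poly :: "K list \<Rightarrow> K \<Rightarrow> K" where
  "additive_poly [] y = 0"
| "additive_poly (k # ks) y = k * y + additive_poly ks (y\<^sup>2)"

lemma additive_poly_add:
  "additive_poly ks (x + y) = additive_poly ks x + additive_poly ks y"
  by (induction ks arbitrary: x y) (simp_all add: K_square_add algebra_simps)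

lemma additive_poly_sum:
  "\<exists>ms. \<forall>y. additive_poly ms y = additive_poly ks y + additive_poly ls y"
proof (induction ks arbitrary: ls)
  case Nil
  then show ?case by auto
next
  case (Cons k ks)
  show ?case
  proof (cases ls)
    case Nil
    then show ?thesis by (intro exI[of _ "k # ks"]) simp
  next
    case (Cons l ls')
    obtain ms where "\<forall>y. additive_poly ms y = additive_poly ks y + additive_poly ls' y"
      using Cons.IH by blast
    then have "\<forall>y. additive_poly ((k + l) # ms) y
        = additive_poly (k # ks) y + additive_poly ls y"
      by (simp add: Cons algebra_simps)
    then show ?thesis by blast
  qed
qed

lemma additive_poly_scale_argument:
  "\<exists>ms. length ms = length ks \<and> (\<forall>y. additive_poly ms y = additive_poly ks (c * y))"
proof (induction ks arbitrary: c)
  case Nil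
  then show ?case by simp
next
  case (Cons k ks)
  obtain ms where "length ms = length ks"
      "\<forall>y. additive_poly ms y = additive_poly ks (c\<^sup>2 * y)"
    using Cons.IH by blast
  then have "length ((k * c) # ms) = length (k # ks) \<and>
      (\<forall>y. additive_poly ((k * c) # ms) y = additive_poly (k # ks) (c * y))"
    by (simp add: power_mult_distrib algebra_simps)
  then show ?case by blast
qed

lemma additive_poly_scale:
  "c * additive_poly ks y = additive_poly (map ((*) c) ks) y"
  by (induction ks arbitrary: y) (simp_all add: algebra_simps)

lemma additive_poly_square:
  "(additive_poly ks y)\<^sup>2 = additive_poly (map (\<lambda>k. k\<^sup>2) ks) (y\<^sup>2)"
  by (induction ks arbitrary: y) (simp_all add: K_square_add power_mult_distrib)

lemma additive_poly_frobenius: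
  "\<exists>ls. \<forall>y. additive_poly ks y ^ (2 ^ m) = additive_poly ls (y ^ (2 ^ m))"
proof (induction m)
  case 0
  then show ?case by auto
next
  case (Suc m)
  then obtain ls where ls: "\<forall>y. additive_poly ks y ^ (2 ^ m) = additive_poly ls (y ^ (2 ^ m))"
    by blast
  have "additive_poly ks y ^ (2 ^ Suc m)
      = additive_poly (map (\<lambda>k. k\<^sup>2) ls) (y ^ (2 ^ Suc m))" for y
    using ls by (simp add: power_mult additive_poly_square mult.commute[of 2])
  then show ?case by blast
qed

lemma additive_poly_shift: "additive_poly (replicate m 0 @ ks) y = additive_poly ks (y ^ (2 ^ m))"
  by (induction m arbitrary: y) (simp_all add: power_mult)

lemma additive_poly_comp:
  "\<exists>ms. \<forall>y. additive_poly ms y = additive_poly ks (additive_poly ls y)"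
proof (induction ks arbitrary: ls)
  case Nil
  show ?case by (rule exI[of _ "[]"]) simp
next
  case (Cons k ks)
  obtain ms where ms: "\<forall>y. additive_poly ms y
      = additive_poly ks (additive_poly (0 # map (\<lambda>k. k\<^sup>2) ls) y)"
    using Cons.IH by blast
  obtain ns where "\<forall>y. additive_poly ns y
      = additive_poly (map ((*) k) ls) y + additive_poly ms y"
    using additive_poly_sum by blast
  then have "\<forall>y. additive_poly ns y = additive_poly (k # ks) (additive_poly ls y)"
    using ms by (simp add: additive_poly_scale additive_poly_square)
  then show ?case by blast
qed

section \<open>The ring of operators generated by scalars and the squaring map\<close>

text \<open>
  These are the maps \<open>\<phi>\<^sup>-\<^sup>m \<circ> p\<close> with \<open>p\<close> an additive polynomial and \<open>\<phi>\<close> the squaring map.  The inverse of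
  \<open>\<phi>\<close> has to be admitted: the additive polynomials alone do not form a fadelian ring, because
  \<open>\<phi> \<circ> b + c \<circ> \<phi>\<close> has no linear term, so that it is never the identity.
\<close>

typedef frobenius_op = "{f :: K \<Rightarrow> K. \<exists>m ks. \<forall>y. f y ^ (2 ^ m) = additive_poly ks y}"
  morphisms apply_op Frobenius_Op
proof
  show "(\<lambda>y. 0) \<in> {f :: K \<Rightarrow> K. \<exists>m ks. \<forall>y. f y ^ (2 ^ m) = additive_poly ks y}"
    by (auto intro!: exI[of _ 0] exI[of _ "[]"])
qed

setup_lifting type_definition_frobenius_op

lemma apply_op_eqI: "(\<And>y. apply_op f y = apply_op g y) \<Longrightarrow> f = g"
  by (metis apply_op_inject ext)

text \<open>
  Both summands are raised to the common power \<open>2\<^bsup>m + n\<^esup>\<close>; the Frobenius power of an additive polynomial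
  is one in the same power of the argument.
\<close>

lemma frobenius_op_sum_closed:
  assumes f: "\<forall>y. f y ^ (2 ^ m) = additive_poly ks y" and g: "\<forall>y. g y ^ (2 ^ n) = additive_poly ls y"
  shows "\<exists>k ms. \<forall>y. (f y + g y) ^ (2 ^ k) = additive_poly ms y"
proof -
  obtain ks' where ks': "\<forall>y. additive_poly ks y ^ (2 ^ n) = additive_poly ks' (y ^ (2 ^ n))"
    using additive_poly_frobenius by blast
  obtain ls' where ls': "\<forall>y. additive_poly ls y ^ (2 ^ m) = additive_poly ls' (y ^ (2 ^ m))"
    using additive_poly_frobenius by blast
  obtain ms where ms: "\<forall>y. additive_poly ms y
      = additive_poly (replicate n 0 @ ks') y + additive_poly (replicate m 0 @ ls') y"
    using additive_poly_sum by blast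
  have "(f y + g y) ^ (2 ^ (m + n)) = additive_poly ms y" for y
  proof -
    have "f y ^ (2 ^ (m + n)) = additive_poly ks' (y ^ (2 ^ n))"
      using f ks' by (simp add: power_add power_mult)
    moreover have "g y ^ (2 ^ (m + n)) = additive_poly ls' (y ^ (2 ^ m))"
      using g ls' by (simp add: power_add power_mult mult.commute[of "2 ^ m"])
    ultimately show ?thesis
      using ms by (simp add: K_frobenius_add additive_poly_shift)
  qed
  then show ?thesis by blast
qed

lemma frobenius_op_comp_closed:
  assumes f: "\<forall>y. f y ^ (2 ^ m) = additive_poly ks y" and g: "\<forall>y. g y ^ (2 ^ n) = additive_poly ls y"
  shows "\<exists>k ms. \<forall>y. f (g y) ^ (2 ^ k) = additive_poly ms y"
proof -
  obtain ks' where ks': "\<forall>y. additive_poly ks y ^ (2 ^ n) = additive_poly ks' (y ^ (2 ^ n))"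
    using additive_poly_frobenius by blast
  obtain ms where ms: "\<forall>y. additive_poly ms y = additive_poly ks' (additive_poly ls y)"
    using additive_poly_comp by blast
  have "f (g y) ^ (2 ^ (m + n)) = additive_poly ms y" for y
    using f g ks' ms by (simp add: power_add power_mult)
  then show ?thesis by blast
qed

lemma apply_op_add: "apply_op f (x + y) = apply_op f x + apply_op f y"
proof (transfer fixing: x y)
  fix f :: "K \<Rightarrow> K"
  assume "\<exists>m ks. \<forall>y. f y ^ (2 ^ m) = additive_poly ks y"
  then obtain m ks where "\<And>y. f y ^ (2 ^ m) = additive_poly ks y" by blast
  then have "f (x + y) ^ (2 ^ m) = (f x + f y) ^ (2 ^ m)"
    by (simp add: additive_poly_add K_frobenius_add)
  then show "f (x + y) = f x + f y"
    by (simp only: K_frobenius_inject)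
qed

lemma apply_op_0: "apply_op f 0 = 0"
  using apply_op_add[of f 0 0] by (metis add.right_neutral add_left_cancel)

lemma apply_op_minus: "apply_op f (x - y) = apply_op f x - apply_op f y"
  by (simp add: K_minus apply_op_add)

text \<open>
  Multiplication is composition, so this is the skew Laurent polynomial ring of the squaring map,
  realised faithfully as a ring of additive maps on \<^typ>\<open>K\<close>.  The realisation makes kernels and images
  available: they carry all the arguments below.
\<close>

instantiation frobenius_op :: ring_1
begin

lift_definition zero_frobenius_op :: frobenius_op is "\<lambda>y. 0"
  by (auto intro!: exI[of _ 0] exI[of _ "[]"])

lift_definition one_frobenius_op :: frobenius_op is "\<lambda>y. y"
  by (auto intro!: exI[of _ 0] exI[of _ "[1]"])

lift_definition plus_frobenius_op :: "frobenius_op \<Rightarrow> frobenius_op \<Rightarrow> frobenius_op"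
  is "\<lambda>f g y. f y + g y"
  using frobenius_op_sum_closed by blast

lift_definition uminus_frobenius_op :: "frobenius_op \<Rightarrow> frobenius_op"
  is "\<lambda>f y. - f y"
  by (simp add: K_uminus)

lift_definition minus_frobenius_op :: "frobenius_op \<Rightarrow> frobenius_op \<Rightarrow> frobenius_op"
  is "\<lambda>f g y. f y - g y"
  unfolding K_minus using frobenius_op_sum_closed by blast

lift_definition times_frobenius_op :: "frobenius_op \<Rightarrow> frobenius_op \<Rightarrow> frobenius_op"
  is "\<lambda>f g y. f (g y)"
  using frobenius_op_comp_closed by blast

lemmas apply_op_simps [simp] = zero_frobenius_op.rep_eq one_frobenius_op.rep_eq
  plus_frobenius_op.rep_eq uminus_frobenius_op.rep_eq minus_frobenius_op.rep_eq
  times_frobenius_op.rep_eq apply_op_add apply_op_0 apply_op_minus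

instance
proof
  have "apply_op (0 :: frobenius_op) 1 \<noteq> apply_op 1 1"
    by simp
  then show "(0 :: frobenius_op) \<noteq> 1"
    by metis
qed (rule apply_op_eqI; simp add: algebra_simps)+

end

section \<open>Factorization into units and Artin--Schreier maps\<close>

definition scalar :: "K \<Rightarrow> frobenius_op" where
  "scalar k = Frobenius_Op (\<lambda>y. k * y)"

lemma apply_scalar [simp]: "apply_op (scalar k) y = k * y"
proof -
  have "(\<lambda>y. k * y) \<in> {f. \<exists>m ks. \<forall>y. f y ^ (2 ^ m) = additive_poly ks y}"
    by (auto intro!: exI[of _ 0] exI[of _ "[k]"])
  then show ?thesis
    by (simp add: scalar_def Frobenius_Op_inverse)
qed

lift_definition frobenius :: frobenius_op is "\<lambda>y. y\<^sup>2"
  by (auto intro!: exI[of _ 0] exI[of _ "[0, 1]"])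

lift_definition inverse_frobenius :: frobenius_op is "\<lambda>y. SOME x. x\<^sup>2 = y"
  by (rule exI[of _ 1], rule exI[of _ "[1]"]) (simp add: someI_ex[OF K_square_root])

definition artin_schreier :: frobenius_op where
  "artin_schreier = frobenius + 1"

declare frobenius.rep_eq [simp]

lemma apply_artin_schreier [simp]: "apply_op artin_schreier y = y\<^sup>2 + y"
  by (simp add: artin_schreier_def)

lemma inverse_frobenius [simp]:
  "frobenius * inverse_frobenius = 1" "inverse_frobenius * frobenius = 1"
proof -
  have sq: "(apply_op inverse_frobenius y)\<^sup>2 = y" for y
    by (simp add: inverse_frobenius.rep_eq someI_ex[OF K_square_root])
  show "frobenius * inverse_frobenius = 1"
    by (rule apply_op_eqI) (simp add: sq)
  have "(apply_op inverse_frobenius (y\<^sup>2))\<^sup>2 = y\<^sup>2" for y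
    by (rule sq)
  then show "inverse_frobenius * frobenius = 1"
    by (intro apply_op_eqI) (simp add: K_square_inject)
qed

text \<open>
  Division with remainder by \<open>y\<^sup>2 + y\<close>.  The remainder \<open>r y\<close> of the tail reappears as \<open>r y\<^sup>2\<close>
  in the whole polynomial and is divided once more: \<open>r y\<^sup>2 = r (y\<^sup>2 + y) + r y\<close> in characteristic two.
\<close>

lemma additive_poly_divide_artin_schreier:
  "\<exists>ls r. length ls \<le> length ks \<and>
     (\<forall>y. additive_poly (k # ks) y = additive_poly ls (y\<^sup>2 + y) + r * y)"
proof (induction ks arbitrary: k)
  case Nil
  then show ?case by auto
next
  case (Cons k' ks)
  obtain ls r where len: "length ls \<le> length ks" and
      eq: "\<And>y. additive_poly (k' # ks) y = additive_poly ls (y\<^sup>2 + y) + r * y"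
    using Cons.IH by blast
  have "additive_poly (k # k' # ks) y = additive_poly (r # ls) (y\<^sup>2 + y) + (k + r) * y" for y
  proof -
    have "additive_poly (k # k' # ks) y = k * y + additive_poly ls ((y\<^sup>2 + y)\<^sup>2) + r * y\<^sup>2"
      by (simp only: additive_poly.simps(2)[of k] eq[of "y\<^sup>2"] K_square_add add.assoc)
    also have "\<dots> = k * y + additive_poly ls ((y\<^sup>2 + y)\<^sup>2) + r * y\<^sup>2 + (r * y + r * y)"
      by (simp add: K_add_self)
    finally show ?thesis
      by (simp add: algebra_simps)
  qed
  moreover have "length (r # ls) \<le> length (k' # ks)"
    using len by simp
  ultimately show ?case by blast
qed

text \<open>
  As \<open>y\<^sup>2 + y\<close> vanishes at \<open>1\<close>, the value at \<open>1\<close> is the coefficient \<open>r\<close> of the remainder.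
\<close>

lemma additive_poly_factor_artin_schreier:
  assumes "additive_poly ks 1 = 0"
  shows "\<exists>ls. (ks \<noteq> [] \<longrightarrow> length ls < length ks) \<and>
     (\<forall>y. additive_poly ks y = additive_poly ls (y\<^sup>2 + y))"
proof (cases ks)
  case Nil
  then show ?thesis by (auto intro!: exI[of _ "[]"])
next
  case (Cons k ks')
  obtain ls r where len: "length ls \<le> length ks'" and
      ls: "\<And>y. additive_poly ks y = additive_poly ls (y\<^sup>2 + y) + r * y"
    unfolding Cons using additive_poly_divide_artin_schreier by blast
  have "additive_poly ls 0 = 0"
    using additive_poly_add[of ls 0 0] by (metis add.right_neutral add_left_cancel)
  then have "r = 0"
    using ls[of 1] assms by (simp add: K_add_self)
  then show ?thesis
    using ls len Cons by (intro exI[of _ ls]) simp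
qed

text \<open>
  The kernel of the Artin--Schreier map is \<open>{0, 1}\<close>, so this is the factorization of a map through a
  quotient map.  The factor is again an operator: it is obtained from the quotient of the additive
  polynomials by extracting a root of order a power of two.
\<close>

lemma apply_artin_schreier_factor:
  assumes "apply_op u 1 = 0"
  shows "\<exists>c. u = c * artin_schreier"
proof -
  obtain m ks where u: "\<And>y. apply_op u y ^ (2 ^ m) = additive_poly ks y"
    using apply_op[of u] by auto
  have "additive_poly ks 1 = 0"
    using u[of 1] assms by (metis power_eq_0_iff zero_less_numeral zero_less_power power_0_left neq0_conv)
  then obtain ls where ls: "\<And>y. additive_poly ks y = additive_poly ls (y\<^sup>2 + y)"
    using additive_poly_factor_artin_schreier by blast
  define c where "c = Frobenius_Op (\<lambda>w. SOME x. x ^ (2 ^ m) = additive_poly ls w)"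
  have root: "(SOME x. x ^ (2 ^ m) = y) ^ (2 ^ m) = y" for y :: K
    by (rule someI_ex) (use nth_root_exists[of "2 ^ m" y] in auto)
  then have "(\<lambda>w. SOME x. x ^ (2 ^ m) = additive_poly ls w)
      \<in> {f. \<exists>m ks. \<forall>y. f y ^ (2 ^ m) = additive_poly ks y}"
    by blast
  then have c: "apply_op c y ^ (2 ^ m) = additive_poly ls y" for y
    by (simp add: c_def Frobenius_Op_inverse root)
  have "u = c * artin_schreier"
  proof (rule apply_op_eqI)
    fix y
    have "apply_op u y ^ (2 ^ m) = apply_op (c * artin_schreier) y ^ (2 ^ m)"
      using u[of y] ls[of y] c[of "y\<^sup>2 + y"] by (simp del: apply_op_add)
    then show "apply_op u y = apply_op (c * artin_schreier) y"
      by (simp only: K_frobenius_inject)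
  qed
  then show ?thesis ..
qed


lemma apply_frobenius_power: "apply_op (frobenius ^ m) y = y ^ (2 ^ m)"
  by (induction m arbitrary: y) (simp_all add: power_Suc2 power_mult power2_eq_square power_mult_distrib del: power_Suc)

text \<open>
  The polynomial whose product with \<open>y\<close> is the additive polynomial: its roots are the nonzero
  elements of the kernel when the linear coefficient is nonzero.
\<close>

fun root_poly :: "K list \<Rightarrow> K poly" where
  "root_poly [] = 0"
| "root_poly (k # ks) = [:k:] + [:0, 1:] * pcompose (root_poly ks) [:0, 0, 1:]"

lemma additive_poly_eq_root_poly: "additive_poly ks y = y * poly (root_poly ks) y"
  by (induction ks arbitrary: y) (simp_all add: poly_pcompose algebra_simps power2_eq_square)

text \<open>
  Up to units, the Artin--Schreier map is the only irreducible operator.  After splitting off powers of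
  the squaring map, a nonzero operator \<open>f\<close> is an additive polynomial with nonzero linear coefficient.
  Either it is a scalar, or it has a nonzero root \<open>y\<close> because the field is algebraically closed.  In the
  latter case \<open>f \<circ> scalar y\<close> kills \<open>1\<close>, hence is \<open>g\<close> times the Artin--Schreier map, and \<open>g\<close> has a
  shorter list of coefficients.
\<close>

lemma frobenius_op_induct [consumes 1, case_names unit artin_schreier mult]:
  assumes "f \<noteq> 0"
    and unit: "\<And>u v. u * v = 1 \<Longrightarrow> v * u = 1 \<Longrightarrow> P u"
    and AS: "P artin_schreier"
    and mult: "\<And>f g. P f \<Longrightarrow> P g \<Longrightarrow> P (f * g)"
  shows "P f"
proof -
  have scalar: "P (scalar k)" if "k \<noteq> 0" for k
  proof (rule unit)
    show "scalar k * scalar (1 / k) = 1" "scalar (1 / k) * scalar k = 1"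
      by (rule apply_op_eqI; use that in simp)+
  qed
  have frob: "P frobenius" "P inverse_frobenius"
    using unit inverse_frobenius by blast+
  have poly_case: "P f" if "\<And>y. apply_op f y = additive_poly ks y" "f \<noteq> 0" for f ks
    using that
  proof (induction "length ks" arbitrary: f ks rule: less_induct)
    case less
    show ?case
    proof (cases ks)
      case Nil
      then have "f = 0"
        using less.prems by (intro apply_op_eqI) simp
      then show ?thesis using less.prems by simp
    next
      case (Cons k ks')
      show ?thesis
      proof (cases "k = 0")
        case True
        have "f = (f * inverse_frobenius) * frobenius"
          by (simp add: mult.assoc)
        have f: "apply_op (f * inverse_frobenius) y = additive_poly ks' y" for y
        proof -
          have "(apply_op inverse_frobenius y)\<^sup>2 = apply_op (frobenius * inverse_frobenius) y"
            by (simp del: inverse_frobenius)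
          also have "\<dots> = y" by simp
          finally show ?thesis
            using less.prems(1) Cons True by simp
        qed
        moreover have "f * inverse_frobenius \<noteq> 0"
          using \<open>f = _\<close> less.prems(2) by auto
        ultimately have "P (f * inverse_frobenius)"
          using less.hyps[of ks'] Cons by simp
        then show ?thesis
          using \<open>f = _\<close> mult frob by metis
      next
        case False
        show ?thesis
        proof (cases "degree (root_poly ks) = 0")
          case True
          then obtain c where c: "root_poly ks = [:c:]"
            by (metis degree_eq_zeroE)
          then have "f = scalar c"
            using less.prems(1) by (intro apply_op_eqI) (simp add: additive_poly_eq_root_poly mult.commute)
          moreover have "c \<noteq> 0"
            using \<open>f = scalar c\<close> less.prems(2) by (metis apply_op_eqI apply_scalar mult_zero_left apply_op_simps(1))
          ultimately show ?thesis
            using scalar by simp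
        next
          case False
          then obtain y where y: "poly (root_poly ks) y = 0"
            using alg_closed_imp_poly_has_root[of "root_poly ks"] by auto
          have "y \<noteq> 0"
            using y \<open>k \<noteq> 0\<close> Cons by (auto simp: poly_pcompose)
          obtain ms where len: "length ms = length ks"
            and ms: "\<forall>w. additive_poly ms w = additive_poly ks (y * w)"
            using additive_poly_scale_argument by blast
          \<comment> \<open>\<open>ms\<close> represents \<open>f * scalar y\<close>, which vanishes at 1 by the choice of \<open>y\<close>\<close>
          have "additive_poly ms 1 = 0"
            using ms[rule_format, of 1] y additive_poly_eq_root_poly[of ks y] by simp
          then obtain ls where ls: "length ls < length ms"
            "\<And>w. additive_poly ms w = additive_poly ls (w\<^sup>2 + w)"
            using additive_poly_factor_artin_schreier[of ms] len Cons by auto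
          define g where "g = Frobenius_Op (additive_poly ls)"
          have g: "apply_op g = additive_poly ls"
            unfolding g_def by (rule Frobenius_Op_inverse) (auto intro!: exI[of _ 0])
          have f: "f = g * artin_schreier * scalar (1 / y)"
          proof (rule apply_op_eqI)
            fix w
            show "apply_op f w = apply_op (g * artin_schreier * scalar (1 / y)) w"
              using less.prems(1)[of w] ms[rule_format, of "w / y"] ls(2)[of "w / y"] g \<open>y \<noteq> 0\<close>
              by simp
          qed
          then have "g \<noteq> 0"
            using less.prems(2) by auto
          then have "P g"
            using less.hyps[of ls g] g ls(1) len by simp
          then show ?thesis
            using f mult AS scalar \<open>y \<noteq> 0\<close> by simp
        qed
      qed
    qed
  qed
  obtain m ks where ks: "\<And>y. apply_op f y ^ (2 ^ m) = additive_poly ks y"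
    using apply_op[of f] by auto
  have inv: "inverse_frobenius ^ m * frobenius ^ m = 1" for m
  proof (induction m)
    case (Suc m)
    have "inverse_frobenius ^ Suc m * frobenius ^ Suc m
        = inverse_frobenius ^ m * (inverse_frobenius * frobenius) * frobenius ^ m"
      by (simp only: power_Suc2[of inverse_frobenius] power_Suc[of frobenius] mult.assoc)
    then show ?case using Suc by simp
  qed simp
  have f: "f = inverse_frobenius ^ m * (frobenius ^ m * f)"
    by (simp add: mult.assoc[symmetric] inv)
  have "P (frobenius ^ m * f)"
  proof (rule poly_case)
    show "apply_op (frobenius ^ m * f) y = additive_poly ks y" for y
      using ks by (simp add: apply_frobenius_power)
    show "frobenius ^ m * f \<noteq> 0"
      using f assms(1) by auto
  qed
  moreover have "P (inverse_frobenius ^ m)"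
    by (induction m) (use unit[of 1 1] mult frob in auto)
  ultimately show ?thesis
    using mult f by metis
qed

section \<open>The fadelian property of the operator ring\<close>

lemma artin_schreier_root: "\<exists>x. x\<^sup>2 + x = (z :: K)"
proof -
  obtain x where "poly [:z, 1, 1:] x = 0"
    using alg_closed_imp_poly_has_root[of "[:z, 1, 1 :: K:]"] by auto
  then have "x\<^sup>2 + x + z = 0"
    by (simp add: algebra_simps power2_eq_square)
  then have "x\<^sup>2 + x = z"
    by (simp add: add_eq_0_iff2 K_uminus)
  then show ?thesis ..
qed

lemma surj_apply_op:
  assumes "f \<noteq> 0"
  shows "surj (apply_op f)"
  using assms
proof (induction rule: frobenius_op_induct)
  case (unit u v)
  then show ?case
    by (metis one_frobenius_op.rep_eq surjI times_frobenius_op.rep_eq)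
next
  case artin_schreier
  show ?case
    by (auto simp: surj_def) (metis artin_schreier_root)
next
  case (mult f g)
  then show ?case
    by (simp add: surj_def) metis
qed

instance frobenius_op :: ring_1_no_zero_divisors
proof
  fix f g :: frobenius_op
  assume "f \<noteq> 0" "g \<noteq> 0"
  then have "surj (apply_op f)" "surj (apply_op g)"
    by (simp_all add: surj_apply_op)
  then obtain x y where "apply_op f x = 1" "apply_op g y = x"
    by (metis surjD)
  then have "apply_op (f * g) y \<noteq> apply_op 0 y"
    by simp
  then show "f * g \<noteq> 0"
    by metis
qed

text \<open>
  This is stronger than the fadelian property, which is the case \<open>r = f\<close>; allowing two different
  elements makes the claim multiplicative in \<open>f\<close>, so that it reduces to units and the
  Artin--Schreier map.  For the latter, \<open>x - r * b\<close> only has to vanish at \<open>1\<close>.  A scalar \<open>b\<close> suffices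
  for that, since \<open>r\<close> is surjective.
\<close>

lemma frobenius_op_two_sided:
  fixes f r x :: frobenius_op
  assumes "f \<noteq> 0" "r \<noteq> 0"
  shows "\<exists>b c. x = r * b + c * f"
  using assms(1)
proof (induction f arbitrary: x rule: frobenius_op_induct)
  case (unit u v)
  then have "x = r * 0 + (x * v) * u"
    by (simp add: mult.assoc)
  then show ?case by blast
next
  case artin_schreier
  obtain k where "apply_op r k = apply_op x 1"
    using surj_apply_op[OF assms(2)] by (metis surjD)
  then have "apply_op (x - r * scalar k) 1 = 0"
    by simp
  then obtain c where "x - r * scalar k = c * artin_schreier"
    using apply_artin_schreier_factor by blast
  then have "x = r * scalar k + c * artin_schreier"
    by (simp add: algebra_simps)
  then show ?case by blast
next
  case (mult f g)
  obtain b c where x: "x = r * b + c * g"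
    using mult by blast
  obtain b' c' where "c = r * b' + c' * f"
    using mult by blast
  then have "x = r * (b + b' * g) + c' * (f * g)"
    using x by (simp add: algebra_simps)
  then show ?case by blast
qed

lemma artin_schreier_nonzero: "artin_schreier \<noteq> 0"
proof -
  obtain y where "apply_op artin_schreier y = 1"
    using artin_schreier_root[of 1] by auto
  then show ?thesis
    by (metis apply_op_simps(1) zero_neq_one)
qed

text \<open>
  A right inverse \<open>r\<close> would be injective, but it is also surjective, so the Artin--Schreier map would
  separate \<open>0\<close> and \<open>1\<close>, which both lie in its kernel.
\<close>

lemma artin_schreier_not_invertible: "artin_schreier * r \<noteq> 1"
proof
  assume r: "artin_schreier * r = 1"
  then have "r \<noteq> 0" by auto
  then obtain y z where "apply_op r y = 0" "apply_op r z = 1"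
    using surj_apply_op by (metis surjD)
  then have "apply_op (artin_schreier * r) y = apply_op (artin_schreier * r) z"
    by (simp add: K_add_self)
  then have "y = z"
    by (simp add: r)
  then show False
    using \<open>apply_op r y = 0\<close> \<open>apply_op r z = 1\<close> by simp
qed

section \<open>Ascending chains of principal one-sided ideals\<close>

context ring
begin

lemma left_ideal_principal:
  assumes a: "a \<in> carrier R"
  shows "left_ideal ((\<lambda>r. r \<otimes> a) ` carrier R) R"
proof -
  have "subgroup ((\<lambda>r. r \<otimes> a) ` carrier R) (add_monoid R)"
  proof (rule subgroup.intro)
    fix x assume "x \<in> (\<lambda>r. r \<otimes> a) ` carrier R"
    then obtain r where r: "r \<in> carrier R" "x = r \<otimes> a" by blast
    then have "\<ominus> x = (\<ominus> r) \<otimes> a"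
      using a by (simp add: l_minus)
    then show "inv\<^bsub>add_monoid R\<^esub> x \<in> (\<lambda>r. r \<otimes> a) ` carrier R"
      using r unfolding a_inv_def[symmetric] by blast
  next
    fix x y assume "x \<in> (\<lambda>r. r \<otimes> a) ` carrier R" "y \<in> (\<lambda>r. r \<otimes> a) ` carrier R"
    then obtain r s where "r \<in> carrier R" "s \<in> carrier R" "x = r \<otimes> a" "y = s \<otimes> a" by blast
    then have "x \<oplus> y = (r \<oplus> s) \<otimes> a" "r \<oplus> s \<in> carrier R"
      using a by (simp_all add: l_distr)
    then show "x \<otimes>\<^bsub>add_monoid R\<^esub> y \<in> (\<lambda>r. r \<otimes> a) ` carrier R"
      by auto
  next
    have "\<zero> = \<zero> \<otimes> a" using a by simp
    then show "\<one>\<^bsub>add_monoid R\<^esub> \<in> (\<lambda>r. r \<otimes> a) ` carrier R"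
      by auto
  qed (use a in auto)
  moreover have "s \<otimes> x \<in> (\<lambda>r. r \<otimes> a) ` carrier R"
    if "x \<in> (\<lambda>r. r \<otimes> a) ` carrier R" "s \<in> carrier R" for x s
    using that a by (auto simp: m_assoc[symmetric])
  ultimately show ?thesis
    by (intro left_ideal.intro left_ideal_axioms.intro additive_subgroup.intro ring_axioms)
qed

lemma right_ideal_principal:
  assumes a: "a \<in> carrier R"
  shows "right_ideal ((\<lambda>r. a \<otimes> r) ` carrier R) R"
proof -
  have "subgroup ((\<lambda>r. a \<otimes> r) ` carrier R) (add_monoid R)"
  proof (rule subgroup.intro)
    fix x assume "x \<in> (\<lambda>r. a \<otimes> r) ` carrier R"
    then obtain r where r: "r \<in> carrier R" "x = a \<otimes> r" by blast
    then have "\<ominus> x = a \<otimes> (\<ominus> r)"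
      using a by (simp add: r_minus)
    then show "inv\<^bsub>add_monoid R\<^esub> x \<in> (\<lambda>r. a \<otimes> r) ` carrier R"
      using r unfolding a_inv_def[symmetric] by blast
  next
    fix x y assume "x \<in> (\<lambda>r. a \<otimes> r) ` carrier R" "y \<in> (\<lambda>r. a \<otimes> r) ` carrier R"
    then obtain r s where "r \<in> carrier R" "s \<in> carrier R" "x = a \<otimes> r" "y = a \<otimes> s" by blast
    then have "x \<oplus> y = a \<otimes> (r \<oplus> s)" "r \<oplus> s \<in> carrier R"
      using a by (simp_all add: r_distr)
    then show "x \<otimes>\<^bsub>add_monoid R\<^esub> y \<in> (\<lambda>r. a \<otimes> r) ` carrier R"
      by auto
  next
    have "\<zero> = a \<otimes> \<zero>" using a by simp
    then show "\<one>\<^bsub>add_monoid R\<^esub> \<in> (\<lambda>r. a \<otimes> r) ` carrier R"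
      by auto
  qed (use a in auto)
  moreover have "x \<otimes> s \<in> (\<lambda>r. a \<otimes> r) ` carrier R"
    if "x \<in> (\<lambda>r. a \<otimes> r) ` carrier R" "s \<in> carrier R" for x s
    using that a by (auto simp: m_assoc)
  ultimately show ?thesis
    by (intro right_ideal.intro right_ideal_axioms.intro additive_subgroup.intro ring_axioms)
qed

lemma not_left_noetherian_if_divisor_chain:
  fixes y :: "nat \<Rightarrow> 'a"
  assumes y: "\<And>n. y n \<in> carrier R"
    and div: "\<And>n. \<exists>r\<in>carrier R. y n = r \<otimes> y (Suc n)"
    and strict: "\<And>n r. r \<in> carrier R \<Longrightarrow> y (Suc n) \<noteq> r \<otimes> y n"
  shows "\<not> left_noetherian R"
proof
  assume noeth: "left_noetherian R"
  define C where "C n = (\<lambda>r. r \<otimes> y n) ` carrier R" for n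
  have "C n \<subseteq> C (Suc n)" for n
  proof -
    obtain r where r: "r \<in> carrier R" "y n = r \<otimes> y (Suc n)"
      using div by blast
    then have "s \<otimes> y n = (s \<otimes> r) \<otimes> y (Suc n)" if "s \<in> carrier R" for s
      using that y by (simp add: m_assoc)
    then show ?thesis
      using r(1) by (auto simp: C_def)
  qed
  moreover have "left_ideal (C n) R" for n
    unfolding C_def by (rule left_ideal_principal[OF y])
  ultimately obtain N where N: "\<forall>n\<ge>N. C n = C N"
    using noeth unfolding left_noetherian_def by blast
  have "C (Suc N) = C N" by (rule N[rule_format]) simp
  moreover have "y (Suc N) \<in> C (Suc N)"
    unfolding C_def using y[of "Suc N"] by (intro image_eqI[of _ _ \<one>]) auto
  ultimately show False
    using strict by (auto simp: C_def)
qed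

lemma not_right_noetherian_if_divisor_chain:
  fixes y :: "nat \<Rightarrow> 'a"
  assumes y: "\<And>n. y n \<in> carrier R"
    and div: "\<And>n. \<exists>r\<in>carrier R. y n = y (Suc n) \<otimes> r"
    and strict: "\<And>n r. r \<in> carrier R \<Longrightarrow> y (Suc n) \<noteq> y n \<otimes> r"
  shows "\<not> right_noetherian R"
proof
  assume noeth: "right_noetherian R"
  define C where "C n = (\<lambda>r. y n \<otimes> r) ` carrier R" for n
  have "C n \<subseteq> C (Suc n)" for n
  proof -
    obtain r where r: "r \<in> carrier R" "y n = y (Suc n) \<otimes> r"
      using div by blast
    then have "y n \<otimes> s = y (Suc n) \<otimes> (r \<otimes> s)" if "s \<in> carrier R" for s
      using that y by (simp add: m_assoc)
    then show ?thesis
      using r(1) by (auto simp: C_def)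
  qed
  moreover have "right_ideal (C n) R" for n
    unfolding C_def by (rule right_ideal_principal[OF y])
  ultimately obtain N where N: "\<forall>n\<ge>N. C n = C N"
    using noeth unfolding right_noetherian_def by blast
  have "C (Suc N) = C N" by (rule N[rule_format]) simp
  moreover have "y (Suc N) \<in> C (Suc N)"
    unfolding C_def using y[of "Suc N"] by (intro image_eqI[of _ _ \<one>]) auto
  ultimately show False
    using strict by (auto simp: C_def)
qed

end

section \<open>Germs of sequences in a fadelian domain\<close>

text \<open>
  Along the subsequence, the filter of cofinite sets behaves like an ultrafilter on the countably many
  given sets.
\<close>

lemma deciding_subsequence:
  fixes A :: "nat \<Rightarrow> nat \<Rightarrow> bool"
  shows "\<exists>d. strict_mono d \<and>
    (\<forall>n. (\<forall>\<^sub>F i in sequentially. A n (d i)) \<or> (\<forall>\<^sub>F i in sequentially. \<not> A n (d i)))"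
proof -
  interpret subseqs "\<lambda>n s. (\<forall>i. A n (s i)) \<or> (\<forall>i. \<not> A n (s i))"
  proof
    fix n :: nat and s :: "nat \<Rightarrow> nat"
    have "infinite {i. A n (s i)} \<or> infinite {i. \<not> A n (s i)}"
      using finite_Collect_disjI[of "\<lambda>i. A n (s i)" "\<lambda>i. \<not> A n (s i)"] by auto
    then obtain r :: "nat \<Rightarrow> nat" where "strict_mono r"
        "(\<forall>i. r i \<in> {i. A n (s i)}) \<or> (\<forall>i. r i \<in> {i. \<not> A n (s i)})"
      using infinite_enumerate by metis
    then show "\<exists>r :: nat \<Rightarrow> nat. strict_mono r \<and>
        ((\<forall>i. A n ((s \<circ> r) i)) \<or> (\<forall>i. \<not> A n ((s \<circ> r) i)))"
      by (intro exI[of _ r]) auto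
  qed
  have holds: "(\<forall>i. A n (diagseq (Suc n + i))) \<or> (\<forall>i. \<not> A n (diagseq (Suc n + i)))" for n
    using diagseq_holds[of n] by (auto simp: o_def)
  have "(\<forall>\<^sub>F i in sequentially. A n (diagseq i)) \<or> (\<forall>\<^sub>F i in sequentially. \<not> A n (diagseq i))" for n
  proof -
    have "\<forall>\<^sub>F i in sequentially. P (diagseq i)" if "\<forall>i. P (diagseq (Suc n + i))" for P
      using that by (subst eventually_sequentially_seg[of _ "Suc n", symmetric])
        (simp add: add.commute)
    from this[of "A n"] this[of "\<lambda>i. \<not> A n i"] show ?thesis
      using holds[of n] by blast
  qed
  then show ?thesis
    using subseq_diagseq by blast
qed

text \<open>
  Names for a countable family of sequences that contains the powers needed for the ideal chains and is
  closed under the ring operations and under solving \<open>x = a b + c a\<close> entrywise.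
  \<open>Right_Factor x a\<close> names a solution \<open>b\<close> and \<open>Left_Factor x a\<close> the matching \<open>c\<close>; \<open>Power n\<close>
  names the sequence \<open>z\<^bsup>i - n\<^esup>\<close>, indexed by \<open>i\<close>.
\<close>

datatype sequence_term =
    Zero | One | Plus sequence_term sequence_term | Neg sequence_term
  | Times sequence_term sequence_term
  | Right_Factor sequence_term sequence_term | Left_Factor sequence_term sequence_term
  | Nonunit | Power nat

instance sequence_term :: countable
  by countable_datatype

locale fadelian_domain_with_nonunit =
  fixes right_factor left_factor :: "'a :: ring_1_no_zero_divisors \<Rightarrow> 'a \<Rightarrow> 'a"
    and z :: 'a
  assumes two_sided: "a \<noteq> 0 \<Longrightarrow> x = a * right_factor x a + left_factor x a * a"
    and nonzero: "z \<noteq> 0"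
    and not_right_invertible: "z * r \<noteq> 1"
begin

text \<open>
  In a domain, a left inverse is also a right inverse.
\<close>

lemma not_left_invertible: "r * z \<noteq> 1"
proof
  assume "r * z = 1"
  then have "(z * r - 1) * z = 0"
    by (simp add: left_diff_distrib mult.assoc)
  then show False
    using nonzero not_right_invertible[of r] by simp
qed

fun entry :: "sequence_term \<Rightarrow> nat \<Rightarrow> 'a" where
  "entry Zero i = 0"
| "entry One i = 1"
| "entry (Plus s t) i = entry s i + entry t i"
| "entry (Neg t) i = - entry t i"
| "entry (Times s t) i = entry s i * entry t i"
| "entry (Right_Factor s t) i = right_factor (entry s i) (entry t i)"
| "entry (Left_Factor s t) i = left_factor (entry s i) (entry t i)"
| "entry Nonunit i = z"
| "entry (Power n) i = z ^ (i - n)"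

end

text \<open>
  Every named sequence is eventually zero or eventually nonzero along \<open>d\<close>, so that a nonzero germ
  has, eventually, only nonzero entries.
\<close>

locale deciding_index_sequence = fadelian_domain_with_nonunit +
  fixes d :: "nat \<Rightarrow> nat"
  assumes mono: "strict_mono d"
    and decides: "(\<forall>\<^sub>F i in sequentially. entry t (d i) = 0) \<or>
      (\<forall>\<^sub>F i in sequentially. entry t (d i) \<noteq> 0)"
begin

definition same_germ :: "sequence_term \<Rightarrow> sequence_term \<Rightarrow> bool" where
  "same_germ s t \<longleftrightarrow> (\<forall>\<^sub>F i in sequentially. entry s (d i) = entry t (d i))"

text \<open>
  The least code of a term with the same germ serves as a canonical representative, which puts the
  ring of germs directly on the natural numbers.
\<close>

definition germ :: "sequence_term \<Rightarrow> nat" where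
  "germ t = (LEAST n. same_germ (from_nat n) t)"

lemma same_germ_refl: "same_germ t t"
  by (simp add: same_germ_def)

lemma same_germ_sym: "same_germ s t \<Longrightarrow> same_germ t s"
  by (simp add: same_germ_def eq_commute)

lemma same_germ_trans:
  assumes "same_germ s t" "same_germ t u"
  shows "same_germ s u"
  using assms unfolding same_germ_def by eventually_elim simp

lemma same_germ_from_nat_germ: "same_germ (from_nat (germ t)) t"
  unfolding germ_def by (rule LeastI[of _ "to_nat t"]) (simp add: same_germ_refl)

lemma germ_eq_iff: "germ s = germ t \<longleftrightarrow> same_germ s t"
proof
  assume "germ s = germ t"
  then show "same_germ s t"
    by (metis same_germ_from_nat_germ same_germ_sym same_germ_trans)
next
  assume "same_germ s t"
  then have "same_germ u s \<longleftrightarrow> same_germ u t" for u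
    by (metis same_germ_sym same_germ_trans)
  then show "germ s = germ t"
    by (simp add: germ_def)
qed

lemma germ_eqI: "(\<And>i. entry s i = entry t i) \<Longrightarrow> germ s = germ t"
  by (simp add: germ_eq_iff same_germ_def)

definition germ_ring :: "nat ring" where
  "germ_ring = \<lparr>carrier = range germ,
     monoid.mult = (\<lambda>m n. germ (Times (from_nat m) (from_nat n))), one = germ One,
     zero = germ Zero, add = (\<lambda>m n. germ (Plus (from_nat m) (from_nat n)))\<rparr>"

lemma germ_ring_simps [simp]:
  "carrier germ_ring = range germ"
  "\<one>\<^bsub>germ_ring\<^esub> = germ One"
  "\<zero>\<^bsub>germ_ring\<^esub> = germ Zero"
  "germ s \<otimes>\<^bsub>germ_ring\<^esub> germ t = germ (Times s t)"
  "germ s \<oplus>\<^bsub>germ_ring\<^esub> germ t = germ (Plus s t)"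
proof -
  have *: "\<forall>\<^sub>F i in sequentially. entry (from_nat (germ t)) (d i) = entry t (d i)" for t
    using same_germ_from_nat_germ same_germ_def by blast
  have "same_germ (Times (from_nat (germ s)) (from_nat (germ t))) (Times s t)"
    "same_germ (Plus (from_nat (germ s)) (from_nat (germ t))) (Plus s t)"
    unfolding same_germ_def using *[of s] *[of t] by (eventually_elim, simp)+
  then show "germ s \<otimes>\<^bsub>germ_ring\<^esub> germ t = germ (Times s t)"
    "germ s \<oplus>\<^bsub>germ_ring\<^esub> germ t = germ (Plus s t)"
    by (simp_all add: germ_ring_def germ_eq_iff)
qed (simp_all add: germ_ring_def)

lemma ring_germ_ring: "ring germ_ring"
proof (rule ringI)
  show "abelian_group germ_ring"
  proof (rule abelian_groupI)
    fix x assume "x \<in> carrier germ_ring"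
    then obtain t where "x = germ t" by auto
    then have "germ (Neg t) \<oplus>\<^bsub>germ_ring\<^esub> x = \<zero>\<^bsub>germ_ring\<^esub>"
      by (auto intro: germ_eqI)
    then show "\<exists>y\<in>carrier germ_ring. y \<oplus>\<^bsub>germ_ring\<^esub> x = \<zero>\<^bsub>germ_ring\<^esub>"
      by auto
  qed (auto intro!: germ_eqI simp: algebra_simps)
  show "monoid germ_ring"
    by (rule monoidI) (auto intro!: germ_eqI simp: algebra_simps)
qed (auto intro!: germ_eqI simp: algebra_simps)

lemma fadelian_germ_ring: "fadelian_ring germ_ring"
proof (intro fadelian_ring.intro ring_germ_ring fadelian_ring_axioms.intro)
  show "\<one>\<^bsub>germ_ring\<^esub> \<noteq> \<zero>\<^bsub>germ_ring\<^esub>"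
    by (simp add: germ_eq_iff same_germ_def)
next
  fix x a
  assume "x \<in> carrier germ_ring" "a \<in> carrier germ_ring" "a \<noteq> \<zero>\<^bsub>germ_ring\<^esub>"
  then obtain s t where st: "x = germ s" "a = germ t"
    by auto
  with \<open>a \<noteq> _\<close> have "\<not> same_germ t Zero"
    by (simp add: germ_eq_iff)
  then have "\<forall>\<^sub>F i in sequentially. entry t (d i) \<noteq> 0"
    using decides by (auto simp: same_germ_def)
  then have "same_germ s (Plus (Times t (Right_Factor s t)) (Times (Left_Factor s t) t))"
    unfolding same_germ_def by eventually_elim (simp add: two_sided[symmetric])
  then have "x = a \<otimes>\<^bsub>germ_ring\<^esub> germ (Right_Factor s t)
      \<oplus>\<^bsub>germ_ring\<^esub> germ (Left_Factor s t) \<otimes>\<^bsub>germ_ring\<^esub> a"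
    by (simp add: st germ_eq_iff)
  then show "\<exists>b\<in>carrier germ_ring. \<exists>c\<in>carrier germ_ring.
      x = a \<otimes>\<^bsub>germ_ring\<^esub> b \<oplus>\<^bsub>germ_ring\<^esub> c \<otimes>\<^bsub>germ_ring\<^esub> a"
    by auto
qed

text \<open>
  Only finitely many indices are lost to the truncated subtraction in the exponent, and germs do not
  see them.  This is why the germ of \<open>Power n\<close> can be divided by \<open>z\<close> again and again.
\<close>

lemma eventually_power_split:
  "\<forall>\<^sub>F i in sequentially. z ^ (d i - n) = z * z ^ (d i - Suc n)"
proof -
  have "z ^ (d i - n) = z * z ^ (d i - Suc n)" if "Suc n \<le> i" for i
  proof -
    have "i \<le> d i"
      using mono by (rule strict_mono_imp_increasing)
    then have "d i - n = Suc (d i - Suc n)"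
      using that by simp
    then show ?thesis by simp
  qed
  then show ?thesis
    unfolding eventually_sequentially by blast
qed

lemma germ_ring_not_left_noetherian: "\<not> left_noetherian germ_ring"
proof (rule ring.not_left_noetherian_if_divisor_chain[OF ring_germ_ring,
      where y = "\<lambda>n. germ (Power n)"])
  fix n
  have "germ (Power n) = germ (Times Nonunit (Power (Suc n)))"
    using eventually_power_split by (simp add: germ_eq_iff same_germ_def)
  then show "\<exists>r\<in>carrier germ_ring. germ (Power n) = r \<otimes>\<^bsub>germ_ring\<^esub> germ (Power (Suc n))"
    by auto
next
  fix n r
  assume "r \<in> carrier germ_ring"
  then obtain t where r: "r = germ t" by auto
  show "germ (Power (Suc n)) \<noteq> r \<otimes>\<^bsub>germ_ring\<^esub> germ (Power n)"
  proof
    assume "germ (Power (Suc n)) = r \<otimes>\<^bsub>germ_ring\<^esub> germ (Power n)"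
    then have "\<forall>\<^sub>F i in sequentially. z ^ (d i - Suc n) = entry t (d i) * z ^ (d i - n)"
      by (simp add: r germ_eq_iff same_germ_def)
    then have "\<forall>\<^sub>F i in sequentially. False"
      using eventually_power_split[of n]
    proof eventually_elim
      case (elim i)
      then have "(entry t (d i) * z - 1) * z ^ (d i - Suc n) = 0"
        by (simp add: left_diff_distrib mult.assoc)
      then show ?case
        using nonzero not_left_invertible by simp
    qed
    then show False by simp
  qed
qed simp

lemma germ_ring_not_right_noetherian: "\<not> right_noetherian germ_ring"
proof (rule ring.not_right_noetherian_if_divisor_chain[OF ring_germ_ring,
      where y = "\<lambda>n. germ (Power n)"])
  fix n
  have "germ (Power n) = germ (Times (Power (Suc n)) Nonunit)"
    using eventually_power_split by (simp add: germ_eq_iff same_germ_def power_commutes)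
  then show "\<exists>r\<in>carrier germ_ring. germ (Power n) = germ (Power (Suc n)) \<otimes>\<^bsub>germ_ring\<^esub> r"
    by auto
next
  fix n r
  assume "r \<in> carrier germ_ring"
  then obtain t where r: "r = germ t" by auto
  show "germ (Power (Suc n)) \<noteq> germ (Power n) \<otimes>\<^bsub>germ_ring\<^esub> r"
  proof
    assume "germ (Power (Suc n)) = germ (Power n) \<otimes>\<^bsub>germ_ring\<^esub> r"
    then have "\<forall>\<^sub>F i in sequentially. z ^ (d i - Suc n) = z ^ (d i - n) * entry t (d i)"
      by (simp add: r germ_eq_iff same_germ_def)
    then have "\<forall>\<^sub>F i in sequentially. False"
      using eventually_power_split[of n]
    proof eventually_elim
      case (elim i)
      then have "z ^ (d i - Suc n) * (z * entry t (d i) - 1) = 0"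
        by (simp add: right_diff_distrib power_commutes mult.assoc[symmetric])
      then show ?case
        using nonzero not_right_invertible by simp
    qed
    then show False by simp
  qed
qed simp

end

text \<open>
  The ring is a countable part of an ultrapower.  Being fadelian is a first-order property and
  passes to the germs, whereas the chain conditions are not first-order: infinitely high powers
  of \<open>z\<close> give a strictly increasing chain of principal ideals on either side.
\<close>

lemma ex_countable_non_noetherian_fadelian_ring:
  fixes z :: "'a :: ring_1_no_zero_divisors"
  assumes fadelian: "\<And>x a :: 'a. a \<noteq> 0 \<Longrightarrow> \<exists>b c. x = a * b + c * a"
    and z: "z \<noteq> 0" "\<And>r. z * r \<noteq> 1"
  shows "\<exists>R :: nat ring. countable (carrier R) \<and> fadelian_ring R \<and>
           \<not> left_noetherian R \<and> \<not> right_noetherian R"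
proof -
  define right where "right x a = (SOME b. \<exists>c. x = a * b + c * a)" for x a :: 'a
  define left where "left x a = (SOME c. x = a * right x a + c * a)" for x a :: 'a
  have "x = a * right x a + left x a * a" if "a \<noteq> 0" for x a
  proof -
    have "\<exists>c. x = a * right x a + c * a"
      unfolding right_def by (rule someI_ex) (rule fadelian[OF that])
    then show ?thesis
      unfolding left_def by (rule someI_ex)
  qed
  then interpret fadelian_domain_with_nonunit right left z
    using z by unfold_locales
  obtain d where "strict_mono d" and d: "\<And>n.
      (\<forall>\<^sub>F i in sequentially. entry (from_nat n) (d i) = 0) \<or>
      (\<forall>\<^sub>F i in sequentially. entry (from_nat n) (d i) \<noteq> 0)"
    using deciding_subsequence[of "\<lambda>n i. entry (from_nat n) i = 0"] by blast
  then interpret deciding_index_sequence right left z d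
  proof unfold_locales
    show "(\<forall>\<^sub>F i in sequentially. entry t (d i) = 0) \<or>
        (\<forall>\<^sub>F i in sequentially. entry t (d i) \<noteq> 0)" for t
      using d[of "to_nat t"] by simp
  qed
  show ?thesis
    using fadelian_germ_ring germ_ring_not_left_noetherian germ_ring_not_right_noetherian
    by (intro exI[of _ germ_ring]) auto
qed

theorem theorem15:
  shows "\<exists>R :: nat ring. countable (carrier R) \<and> fadelian_ring R \<and>
           \<not> left_noetherian R \<and> \<not> right_noetherian R"
proof (rule ex_countable_non_noetherian_fadelian_ring)
  show "\<exists>b c. x = a * b + c * a" if "a \<noteq> 0" for x a :: frobenius_op
    using frobenius_op_two_sided that by blast
qed (rule artin_schreier_nonzero artin_schreier_not_invertible)+

end
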